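(* Let $\Omega\subset\mathbb{R}^N$ be a bounded domain, $k\in\{1,\dots,N\}$, and let $c,f\in C(\Omega)$ be such that $$\|c^+\|_\infty<C_s\,\frac{k}{s}\,(\mathrm{diam}(\Omega))^{-2s}.$$ Let $\mathcal{I}$ be either $\mathcal{I}_k^+$ or $\mathcal{I}_k^-$. If $u\in USC(\overline\Omega)\cap L^\infty(\mathbb{R}^N)$ and $v\in LSC(\overline\Omega)\cap L^\infty(\mathbb{R}^N)$ are respectively a subsolution and a supersolution of $$\begin{cases}\mathcal{I}u+c(x)u=f(x)&\text{in }\Omega\\ u=0&\text{in }\mathbb{R}^N\setminus\Omega,\end{cases}$$ then $u\le v$ in $\Omega$.
   Context: Fix $s\in(0,1)$. $LSC$/$USC$ denote lower/upper semicontinuous functions; functions in $L^\infty(\mathbb{R}^N)$ are bounded measurable functions defined at every point; $c^+=\max\{c,0\}$. Set $\delta(u,x,y)=u(x+y)+u(x-y)-2u(x)$, let $C_s=C_{1,s}>0$ be the normalizing constant of the one-dimensional fractional Laplacian, and let $\mathcal{V}_k$ be the family of $k$-dimensional orthonormal sets in $\mathbb{R}^N$. The operators are $\mathcal{I}_k^+u(x)=\sup_{\{\xi_i\}\in\mathcal{V}_k}\sum_{i=1}^k\mathcal{I}_{\xi_i}u(x)$ and $\mathcal{I}_k^-u(x)=\inf_{\{\xi_i\}\in\mathcal{V}_k}\sum_{i=1}^k\mathcal{I}_{\xi_i}u(x)$, where $\mathcal{I}_\xi u(x)=C_s\int_0^{+\infty}\delta(u,x,\tau\xi)\tau^{-1-2s}\,d\tau$.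 Viscosity solutions: given $g\in C(\Omega\times\mathbb{R})$, a function $u\in L^\infty(\mathbb{R}^N)\cap LSC(\Omega)$ (resp. $USC(\Omega)$) is a supersolution (resp. subsolution) of $\mathcal{I}_k^+u+g(x,u(x))=0$ in $\Omega$ if for every $x_0\in\Omega$, $\rho>0$ and $\varphi\in C^2(B_\rho(x_0))$ such that $x_0$ is a minimum (resp. maximum) point of $u-\varphi$ in $B_\rho(x_0)$, $$C_s\sup_{\{\xi_i\}\in\mathcal{V}_k}\sum_{i=1}^k\left(\int_0^\rho\frac{\delta(\varphi,x_0,\tau\xi_i)}{\tau^{1+2s}}\,d\tau+\int_\rho^{+\infty}\frac{\delta(u,x_0,\tau\xi_i)}{\tau^{1+2s}}\,d\tau\right)+g(x_0,u(x_0))\le 0\quad(\text{resp. }\ge 0).$$ For $\mathcal{I}_k^-$ replace $\sup$ by $\inf$. A subsolution (resp. supersolution) of the Dirichlet problem is a subsolution (resp. supersolution) of the equation in $\Omega$ that in addition is $\le 0$ (resp. $\ge 0$) in $\mathbb{R}^N\setminus\Omega$. *)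

theory Defs
  imports "HOL-Analysis.Analysis"
begin

text \<open>
  The constant \<open>C_{1,s}\<close> for which \<open>C_{1,s} \<integral>_0^\<infinity> (u(x+t) + u(x-t) - 2u(x)) t^{-1-2s} dt\<close> is
  minus the one-dimensional fractional Laplacian, i.e. has Fourier symbol \<open>-\<bar>\<zeta>\<bar>^{2s}\<close>.
\<close>

definition C_frac :: "real \<Rightarrow> real" where
  "C_frac s = 4 powr s * Gamma (1/2 + s) / (sqrt pi * \<bar>Gamma (- s)\<bar>)"

lemma C_frac_pos:
  assumes "0 < s" "s < 1"
  shows "C_frac s > 0"
proof -
  have "- s \<notin> \<int>\<^sub>\<le>\<^sub>0"
  proof
    assume "- s \<in> \<int>\<^sub>\<le>\<^sub>0"
    then obtain n :: nat where "- s = - of_nat n"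
      by (auto elim: nonpos_Ints_cases')
    then have "0 < n" "n < 1" using assms by auto
    then show False by simp
  qed
  then have "Gamma (- s) \<noteq> 0" by (simp add: Gamma_eq_zero_iff)
  moreover have "Gamma (1/2 + s) > 0" using assms by (intro Gamma_real_pos) auto
  ultimately show ?thesis by (simp add: C_frac_def)
qed

definition second_diff :: "('a::euclidean_space \<Rightarrow> real) \<Rightarrow> 'a \<Rightarrow> 'a \<Rightarrow> real" where
  "second_diff u x y = u (x + y) + u (x - y) - 2 * u x"

definition orthonormal_sets :: "nat \<Rightarrow> 'a::euclidean_space set set" where
  "orthonormal_sets k =
     {\<Xi>. finite \<Xi> \<and> card \<Xi> = k \<and> pairwise orthogonal \<Xi> \<and> (\<forall>\<xi>\<in>\<Xi>. norm \<xi> = 1)}"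

definition lsc_on :: "'a::topological_space set \<Rightarrow> ('a \<Rightarrow> real) \<Rightarrow> bool" where
  "lsc_on S u \<longleftrightarrow> (\<forall>x\<in>S. \<forall>a<u x. \<forall>\<^sub>F y in at x within S. a < u y)"

definition usc_on :: "'a::topological_space set \<Rightarrow> ('a \<Rightarrow> real) \<Rightarrow> bool" where
  "usc_on S u \<longleftrightarrow> (\<forall>x\<in>S. \<forall>a>u x. \<forall>\<^sub>F y in at x within S. u y < a)"

text \<open>
  Bounded measurable functions defined at every point. The operators integrate along lines, and
  lines are null sets when the dimension is at least two, so measurability along lines does not
  follow from Lebesgue measurability and is asked for separately. Every bounded Borel function
  qualifies.
\<close>

definition bounded_measurable :: "('a::euclidean_space \<Rightarrow> real) \<Rightarrow> bool" where
  "bounded_measurable u \<longleftrightarrow>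
     bounded (range u) \<and> u \<in> borel_measurable lebesgue \<and>
     (\<forall>x \<xi>. (\<lambda>t::real. u (x + t *\<^sub>R \<xi>)) \<in> borel_measurable lebesgue)"

lemma bounded_measurable_borel:
  fixes u :: "'a::euclidean_space \<Rightarrow> real"
  assumes "bounded (range u)" and [measurable]: "u \<in> borel_measurable borel"
  shows "bounded_measurable u"
proof -
  have "(\<lambda>t::real. u (x + t *\<^sub>R \<xi>)) \<in> borel_measurable lborel" for x \<xi>
    by measurable
  then have "(\<lambda>t::real. u (x + t *\<^sub>R \<xi>)) \<in> borel_measurable lebesgue" for x \<xi>
    by (rule measurable_completion)
  moreover have "u \<in> borel_measurable lebesgue"
    using assms(2) by (intro measurable_completion) simp
  ultimately show ?thesis
    using assms(1) by (simp add: bounded_measurable_def)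
qed

text \<open>Twice continuously differentiable on an open set, with Frechet derivatives.\<close>

definition C2_on :: "('a::euclidean_space \<Rightarrow> real) \<Rightarrow> 'a set \<Rightarrow> bool" where
  "C2_on \<phi> S \<longleftrightarrow>
     (\<exists>(D :: 'a \<Rightarrow> 'a \<Rightarrow>\<^sub>L real) (D2 :: 'a \<Rightarrow> 'a \<Rightarrow>\<^sub>L ('a \<Rightarrow>\<^sub>L real)).
        (\<forall>x\<in>S. (\<phi> has_derivative blinfun_apply (D x)) (at x) \<and>
                (D has_derivative blinfun_apply (D2 x)) (at x)) \<and>
        continuous_on S D2)"

text \<open>
  Lebesgue integral with values in the extended reals: the difference of the integrals of the
  positive and negative parts (\<^const>\<open>ennreal\<close> sends negative reals to \<open>0\<close>). A test function that is
  \<open>C^2\<close> on an open ball may blow up at its boundary. The touching condition bounds it there from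
  one side, so the integrals below never have the form \<open>\<infinity> - \<infinity>\<close>, and within one test all
  infinite values have the same sign.
\<close>

definition ext_integral :: "real set \<Rightarrow> (real \<Rightarrow> real) \<Rightarrow> ereal" where
  "ext_integral A h =
     enn2ereal (\<integral>\<^sup>+\<tau>\<in>A. ennreal (h \<tau>) \<partial>lebesgue) -
     enn2ereal (\<integral>\<^sup>+\<tau>\<in>A. ennreal (- h \<tau>) \<partial>lebesgue)"

text \<open>
  The nonlocal term in the definition of viscosity solutions. The parameter \<open>ext\<close> is \<^const>\<open>Sup\<close> for
  \<open>\<I>_k^+\<close> and \<^const>\<open>Inf\<close> for \<open>\<I>_k^-\<close>.
\<close>

definition test_operator ::
  "(ereal set \<Rightarrow> ereal) \<Rightarrow> real \<Rightarrow> nat \<Rightarrow> real \<Rightarrow>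
   ('a::euclidean_space \<Rightarrow> real) \<Rightarrow> ('a \<Rightarrow> real) \<Rightarrow> 'a \<Rightarrow> ereal" where
  "test_operator ext s k \<rho> \<phi> u x\<^sub>0 =
     ereal (C_frac s) *
     ext ((\<lambda>\<Xi>. \<Sum>\<xi>\<in>\<Xi>.
             ext_integral {0<..<\<rho>} (\<lambda>\<tau>. second_diff \<phi> x\<^sub>0 (\<tau> *\<^sub>R \<xi>) / \<tau> powr (1 + 2 * s)) +
             ext_integral {\<rho><..} (\<lambda>\<tau>. second_diff u x\<^sub>0 (\<tau> *\<^sub>R \<xi>) / \<tau> powr (1 + 2 * s)))
          ` orthonormal_sets k)"

definition viscosity_supersolution ::
  "(ereal set \<Rightarrow> ereal) \<Rightarrow> real \<Rightarrow> nat \<Rightarrow> 'a::euclidean_space set \<Rightarrow>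
   ('a \<Rightarrow> real \<Rightarrow> real) \<Rightarrow> ('a \<Rightarrow> real) \<Rightarrow> bool" where
  "viscosity_supersolution ext s k \<Omega> g u \<longleftrightarrow>
     bounded_measurable u \<and> lsc_on \<Omega> u \<and>
     (\<forall>x\<^sub>0\<in>\<Omega>. \<forall>\<rho>>0. \<forall>\<phi>.
        C2_on \<phi> (ball x\<^sub>0 \<rho>) \<and> (\<forall>x\<in>ball x\<^sub>0 \<rho>. u x\<^sub>0 - \<phi> x\<^sub>0 \<le> u x - \<phi> x) \<longrightarrow>
        test_operator ext s k \<rho> \<phi> u x\<^sub>0 + ereal (g x\<^sub>0 (u x\<^sub>0)) \<le> 0)"

definition viscosity_subsolution ::
  "(ereal set \<Rightarrow> ereal) \<Rightarrow> real \<Rightarrow> nat \<Rightarrow> 'a::euclidean_space set \<Rightarrow>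
   ('a \<Rightarrow> real \<Rightarrow> real) \<Rightarrow> ('a \<Rightarrow> real) \<Rightarrow> bool" where
  "viscosity_subsolution ext s k \<Omega> g u \<longleftrightarrow>
     bounded_measurable u \<and> usc_on \<Omega> u \<and>
     (\<forall>x\<^sub>0\<in>\<Omega>. \<forall>\<rho>>0. \<forall>\<phi>.
        C2_on \<phi> (ball x\<^sub>0 \<rho>) \<and> (\<forall>x\<in>ball x\<^sub>0 \<rho>. u x - \<phi> x \<le> u x\<^sub>0 - \<phi> x\<^sub>0) \<longrightarrow>
        test_operator ext s k \<rho> \<phi> u x\<^sub>0 + ereal (g x\<^sub>0 (u x\<^sub>0)) \<ge> 0)"

definition Dirichlet_supersolution ::
  "(ereal set \<Rightarrow> ereal) \<Rightarrow> real \<Rightarrow> nat \<Rightarrow> 'a::euclidean_space set \<Rightarrow>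
   ('a \<Rightarrow> real \<Rightarrow> real) \<Rightarrow> ('a \<Rightarrow> real) \<Rightarrow> bool" where
  "Dirichlet_supersolution ext s k \<Omega> g u \<longleftrightarrow>
     viscosity_supersolution ext s k \<Omega> g u \<and> (\<forall>x. x \<notin> \<Omega> \<longrightarrow> u x \<ge> 0)"

definition Dirichlet_subsolution ::
  "(ereal set \<Rightarrow> ereal) \<Rightarrow> real \<Rightarrow> nat \<Rightarrow> 'a::euclidean_space set \<Rightarrow>
   ('a \<Rightarrow> real \<Rightarrow> real) \<Rightarrow> ('a \<Rightarrow> real) \<Rightarrow> bool" where
  "Dirichlet_subsolution ext s k \<Omega> g u \<longleftrightarrow>
     viscosity_subsolution ext s k \<Omega> g u \<and> (\<forall>x. x \<notin> \<Omega> \<longrightarrow> u x \<le> 0)"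

end

theory Submission
  imports Defs
begin

text \<open>
  Doubling of variables. Suppose \<open>u - v\<close> has a positive value \<open>M\<close> at some point of \<open>\<Omega>\<close>, and let \<open>(x, y)\<close>
  maximise \<open>u x - v y - n |x - y|\<^sup>2\<close> over the square of the closure of \<open>\<Omega>\<close>. For large \<open>n\<close> one has
  \<open>u (x + z) - v (y + z) \<le> u x - v y\<close> for every translation \<open>z\<close>, because outside \<open>\<Omega>\<close> the signs are
  known and semicontinuity handles the points close to the boundary. For \<open>|z| > diam \<Omega>\<close> the left side
  is even nonpositive. Hence, uniformly in the direction, the nonlocal integrals of \<open>u\<close> at \<open>x\<close> and of
  \<open>v\<close> at \<open>y\<close> differ by at least \<open>2 (u x - v y) \<integral>_d^\<infinity> \<tau>^{-1-2s} d\<tau> = (u x - v y) d^{-2s} / s\<close> with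
  \<open>d = diam \<Omega>\<close>, which survives both the supremum and the infimum over frames. The contribution of the
  quadratic test function vanishes as \<open>\<rho> \<rightarrow> 0\<close> for fixed \<open>n\<close>. Letting \<open>n \<rightarrow> \<infinity>\<close> contradicts the bound on \<open>c\<close>.
\<close>

section \<open>Semicontinuity: closed superlevel sets, maxima on compact sets, products\<close>

text \<open>At the centre \<open>u x < a\<close> is already assumed, so the punctured neighbourhoods
  of the definition may be replaced by full ones.\<close>

lemma usc_on_iff_nhd:
  "usc_on S u \<longleftrightarrow> (\<forall>x\<in>S. \<forall>a>u x. \<exists>T. open T \<and> x \<in> T \<and> (\<forall>y\<in>T \<inter> S. u y < a))"
  unfolding usc_on_def eventually_at_topological by (metis IntD1 IntD2 IntI)

lemma usc_on_uminus:
  assumes "lsc_on S v"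
  shows "usc_on S (\<lambda>x. - v x)"
  unfolding usc_on_def
proof safe
  fix x and a :: real assume "x \<in> S" "- v x < a"
  then have "\<forall>\<^sub>F y in at x within S. - a < v y"
    using assms unfolding lsc_on_def by force
  then show "\<forall>\<^sub>F y in at x within S. - v y < a"
    by (rule eventually_mono) simp
qed

lemma closed_superlevel_usc:
  fixes u :: "'a::topological_space \<Rightarrow> real"
  assumes "closed K" "usc_on K u"
  shows "closed {x\<in>K. t \<le> u x}"
  unfolding closed_def
proof (subst open_subopen, intro ballI)
  fix x assume x: "x \<in> - {x \<in> K. t \<le> u x}"
  show "\<exists>T. open T \<and> x \<in> T \<and> T \<subseteq> - {x \<in> K. t \<le> u x}"
  proof (cases "x \<in> K")
    case True
    with x have "u x < t" by auto
    with True assms(2) obtain T where "open T" "x \<in> T" "\<forall>y\<in>T \<inter> K. u y < t"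
      unfolding usc_on_iff_nhd by blast
    then show ?thesis by (intro exI[of _ T]) force
  next
    case False
    then show ?thesis using assms(1) by (intro exI[of _ "- K"]) auto
  qed
qed

text \<open>The sets \<open>{x\<in>K. u y \<le> u x}\<close> are closed, and finitely many of them
  meet at the best of the finitely many \<open>y\<close>. By compactness all of them have a common
  point, which is a maximiser.\<close>

lemma usc_attains_max:
  fixes u :: "'a::t2_space \<Rightarrow> real"
  assumes K: "compact K" "K \<noteq> {}" and u: "usc_on K u"
  obtains x where "x \<in> K" "\<And>y. y \<in> K \<Longrightarrow> u y \<le> u x"
proof -
  let ?L = "\<lambda>y. {x\<in>K. u y \<le> u x}"
  have "K \<inter> \<Inter> (?L ` K) \<noteq> {}"
  proof (rule compact_imp_fip[OF K(1)])
    show "closed T" if "T \<in> ?L ` K" for T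
    proof -
      from that obtain y where "T = ?L y" by (rule imageE)
      then show ?thesis using closed_superlevel_usc[OF compact_imp_closed[OF K(1)] u] by simp
    qed
    show "K \<inter> \<Inter> F \<noteq> {}" if F: "finite F" "F \<subseteq> ?L ` K" for F
    proof -
      obtain Y where Y: "Y \<subseteq> K" "finite Y" "F = ?L ` Y"
        using finite_subset_image[OF F] by (elim exE conjE)
      show ?thesis
      proof (cases "Y = {}")
        case True then show ?thesis using K Y by auto
      next
        case False
        then have "Max (u ` Y) \<in> u ` Y" using Y by (intro Max_in) auto
        then obtain x where x: "x \<in> Y" "u x = Max (u ` Y)" by auto
        then have "u y \<le> u x" if "y \<in> Y" for y using that Y by auto
        then show ?thesis using x Y by auto
      qed
    qed
  qed
  then show thesis using that by auto
qed

text \<open>Serves two purposes: with \<open>w\<close> the penalty, the doubled functional attains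
  its maximum; with \<open>w = 0\<close>, a lower bound on the difference passes to the limit of the
  maximisers.\<close>

lemma usc_on_diff_Times:
  fixes u v :: "'a::topological_space \<Rightarrow> real"
  assumes u: "usc_on S u" and v: "lsc_on S v" and w: "continuous_on UNIV w"
  shows "usc_on (S \<times> S) (\<lambda>p. u (fst p) - v (snd p) - w p)"
  unfolding usc_on_iff_nhd
proof safe
  fix a b and t :: real
  assume ab: "a \<in> S" "b \<in> S" and t: "u (fst (a, b)) - v (snd (a, b)) - w (a, b) < t"
  \<comment> \<open>The slack is shared equally between \<open>u\<close>, \<open>v\<close> and
    \<open>w\<close>.\<close>
  define e where "e = (t - (u a - v b - w (a, b))) / 3"
  have e: "e > 0" using t by (simp add: e_def)
  obtain T where T: "open T" "a \<in> T" "\<And>y. y \<in> T \<inter> S \<Longrightarrow> u y < u a + e"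
    using u ab e unfolding usc_on_iff_nhd by (metis less_add_same_cancel1)
  obtain T' where T': "open T'" "b \<in> T'" "\<And>y. y \<in> T' \<inter> S \<Longrightarrow> - v y < - v b + e"
    using usc_on_uminus[OF v] ab e unfolding usc_on_iff_nhd by (metis less_add_same_cancel1)
  have "open ((w -` {w (a, b) - e<..}) \<inter> (T \<times> T'))"
    using w T T' by (intro open_Int open_Times) (auto intro: open_vimage)
  moreover have "u p - v q - w (p, q) < t"
    if "p \<in> T \<inter> S" "q \<in> T' \<inter> S" "w (a, b) - e < w (p, q)" for p q
    using T(3)[OF that(1)] T'(3)[OF that(2)] that(3) unfolding e_def by (simp add: field_simps)
  ultimately show "\<exists>T. open T \<and> (a, b) \<in> T \<and>
      (\<forall>y\<in>T \<inter> S \<times> S. u (fst y) - v (snd y) - w y < t)"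
    using T(2) T'(2) e
    by (intro exI[of _ "(w -` {w (a, b) - e<..}) \<inter> (T \<times> T')"]) auto
qed

section \<open>Extended integrals, quadratic test functions and tail integrals\<close>

text \<open>Absolute integrability makes the integrals of both parts finite. The near and tail
  integrals below are of this kind, so they can be estimated in the reals.\<close>

lemma ext_integral_eq:
  assumes "h absolutely_integrable_on A"
  shows "ext_integral A h = ereal (integral A h)"
proof -
  let ?h = "\<lambda>x. indicator A x *\<^sub>R h x"
  have int: "integrable lebesgue ?h" using assms by (simp add: set_integrable_def)
  have p: "(\<integral>\<^sup>+\<tau>\<in>A. ennreal (h \<tau>) \<partial>lebesgue) = (\<integral>\<^sup>+\<tau>. ennreal (?h \<tau>) \<partial>lebesgue)"
    by (intro nn_integral_cong) (simp split: split_indicator)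
  have m: "(\<integral>\<^sup>+\<tau>\<in>A. ennreal (- h \<tau>) \<partial>lebesgue) = (\<integral>\<^sup>+\<tau>. ennreal (- ?h \<tau>) \<partial>lebesgue)"
    by (intro nn_integral_cong) (simp split: split_indicator)
  obtain P where P: "(\<integral>\<^sup>+\<tau>. ennreal (?h \<tau>) \<partial>lebesgue) = ennreal P" "P \<ge> 0"
    using int by (metis ennreal_cases integrableD(2) infinity_ennreal_def)
  obtain Q where Q: "(\<integral>\<^sup>+\<tau>. ennreal (- ?h \<tau>) \<partial>lebesgue) = ennreal Q" "Q \<ge> 0"
    using int by (metis ennreal_cases integrableD(3) infinity_ennreal_def)
  have "integral A h = (LINT x|lebesgue. ?h x)"
    using set_lebesgue_integral_eq_integral(2)[OF assms] by (simp add: set_lebesgue_integral_def)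
  also have "\<dots> = P - Q" using real_lebesgue_integral_def[OF int] P Q by simp
  finally show ?thesis
    unfolding ext_integral_def p m P Q using P Q by (simp add: enn2ereal_ennreal)
qed

text \<open>Freezing one variable of the penalty leaves such a quadratic, up to sign; no other test
  functions are used.\<close>

lemma quadratic_C2_on:
  fixes y :: "'a::euclidean_space"
  shows "C2_on (\<lambda>x. a * (norm (x - y))\<^sup>2) S"
proof -
  \<comment> \<open>The constant second derivative: \<open>2 * a\<close> times the Riesz map sending
    \<open>h\<close> to the functional \<open>inner h\<close>.\<close>
  define L :: "'a \<Rightarrow>\<^sub>L ('a \<Rightarrow>\<^sub>L real)" where
    "L = Blinfun (\<lambda>h. (2 * a) *\<^sub>R blinfun_inner_right h)"
  have bl: "bounded_linear (\<lambda>h::'a. (2 * a) *\<^sub>R blinfun_inner_right h)"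
    by (intro bounded_linear_intros)
  then have L: "blinfun_apply L = (\<lambda>h. (2 * a) *\<^sub>R blinfun_inner_right h)"
    unfolding L_def by (rule bounded_linear_Blinfun_apply)
  have 1: "((\<lambda>x. a * (norm (x - y))\<^sup>2) has_derivative
      blinfun_apply ((2 * a) *\<^sub>R blinfun_inner_right (x - y))) (at x)" for x
    unfolding power2_norm_eq_inner
    by (auto intro!: derivative_eq_intros simp: scaleR_blinfun.rep_eq inner_commute algebra_simps)
  have 2: "((\<lambda>x. (2 * a) *\<^sub>R blinfun_inner_right (x - y)) has_derivative blinfun_apply L) (at x)" for x
    unfolding L
    by (intro bounded_linear.has_derivative[OF bl]) (auto intro!: derivative_eq_intros)
  show ?thesis unfolding C2_on_def
    using 1 2 by (intro exI[of _ "\<lambda>x. (2 * a) *\<^sub>R blinfun_inner_right (x - y)"] exI[of _ "\<lambda>_. L"]) auto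
qed

lemma second_diff_quadratic:
  fixes x y z :: "'a::euclidean_space"
  shows "second_diff (\<lambda>x. a * (norm (x - y))\<^sup>2) x z = 2 * a * (norm z)\<^sup>2"
  unfolding second_diff_def power2_norm_eq_inner
  by (simp add: inner_commute algebra_simps)

text \<open>The second difference is \<open>2 * a * \<tau>\<^sup>2\<close> for every centre and unit
  direction, so the integrand is \<open>2 * a * \<tau> powr (1 - 2 * s)\<close>, integrable at 0
  because \<open>s < 1\<close>. The value is the same for all \<open>\<xi>\<close> and vanishes as
  \<open>\<rho>\<close> tends to 0.\<close>

lemma quadratic_near_integral:
  assumes s: "0 < s" "s < 1" and r: "0 < \<rho>" and xi: "norm \<xi> = 1"
  shows "ext_integral {0<..<\<rho>}
      (\<lambda>\<tau>. second_diff (\<lambda>x::'a::euclidean_space. a * (norm (x - y))\<^sup>2) x (\<tau> *\<^sub>R \<xi>) / \<tau> powr (1 + 2 * s))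
    = ereal (a * \<rho> powr (2 - 2 * s) / (1 - s))"
proof -
  have "((\<lambda>\<tau>. \<tau> powr (1 - 2 * s)) has_integral (\<rho> powr (1 - 2 * s + 1) / (1 - 2 * s + 1))) {0..\<rho>}"
    using s r by (intro has_integral_powr_from_0) auto
  then have *: "((\<lambda>\<tau>. \<tau> powr (1 - 2 * s)) has_integral (\<rho> powr (2 - 2 * s) / (2 - 2 * s))) {0<..<\<rho>}"
    using has_integral_Icc_iff_Ioo[of "\<lambda>\<tau>. \<tau> powr (1 - 2 * s)" _ 0 \<rho>] by simp
  then have "(\<lambda>\<tau>. \<tau> powr (1 - 2 * s)) absolutely_integrable_on {0<..<\<rho>}"
    by (intro nonnegative_absolutely_integrable_1) auto
  then have ai: "(\<lambda>\<tau>. (2 * a) *\<^sub>R \<tau> powr (1 - 2 * s)) absolutely_integrable_on {0<..<\<rho>}"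
    by (rule absolutely_integrable_scaleR_left[rotated, simplified]) 
  have eq: "second_diff (\<lambda>x. a * (norm (x - y))\<^sup>2) x (\<tau> *\<^sub>R \<xi>) / \<tau> powr (1 + 2 * s)
      = (2 * a) *\<^sub>R \<tau> powr (1 - 2 * s)" if "\<tau> \<in> {0<..<\<rho>}" for \<tau>
  proof -
    have "\<tau>\<^sup>2 / \<tau> powr (1 + 2 * s) = \<tau> powr (2 - (1 + 2 * s))"
      using that by (subst powr_diff) (auto simp: powr_numeral)
    then have "2 * a * (\<tau>\<^sup>2 / \<tau> powr (1 + 2 * s)) = 2 * a * \<tau> powr (1 - 2 * s)" by simp
    then show ?thesis using xi by (simp add: second_diff_quadratic)
  qed
  have "integral {0<..<\<rho>} (\<lambda>\<tau>. (2 * a) *\<^sub>R \<tau> powr (1 - 2 * s)) = (2 * a) *\<^sub>R (\<rho> powr (2 - 2 * s) / (2 - 2 * s))"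
    using has_integral_cmul[OF *] by (rule integral_unique)
  also have "\<dots> = a * \<rho> powr (2 - 2 * s) / (1 - s)" using s by (simp add: field_simps)
  finally have "ext_integral {0<..<\<rho>} (\<lambda>\<tau>. (2 * a) *\<^sub>R \<tau> powr (1 - 2 * s)) = ereal (a * \<rho> powr (2 - 2 * s) / (1 - s))"
    using ext_integral_eq[OF ai] by simp
  moreover have "ext_integral {0<..<\<rho>}
      (\<lambda>\<tau>. second_diff (\<lambda>x. a * (norm (x - y))\<^sup>2) x (\<tau> *\<^sub>R \<xi>) / \<tau> powr (1 + 2 * s)) =
    ext_integral {0<..<\<rho>} (\<lambda>\<tau>. (2 * a) *\<^sub>R \<tau> powr (1 - 2 * s))"
    unfolding ext_integral_def
    by (intro arg_cong2[where f="(-)"] arg_cong[where f=enn2ereal] nn_integral_cong)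
       (auto simp: eq split: split_indicator)
  ultimately show ?thesis by simp
qed

lemma tail_has_integral:
  fixes s \<rho> :: real
  assumes "0 < s" "0 < \<rho>"
  shows "((\<lambda>\<tau>. 1 / \<tau> powr (1 + 2 * s)) has_integral (\<rho> powr (- 2 * s) / (2 * s))) {\<rho><..}"
proof -
  have "((\<lambda>\<tau>. \<tau> powr (- 1 - 2 * s)) has_integral - (\<rho> powr (- 1 - 2 * s + 1)) / (- 1 - 2 * s + 1)) {\<rho>..}"
    using assms by (intro has_integral_powr_to_inf) auto
  moreover have "\<tau> powr (- 1 - 2 * s) = 1 / \<tau> powr (1 + 2 * s)" for \<tau>
    using powr_minus_divide[of \<tau> "1 + 2 * s"] by simp
  ultimately have "((\<lambda>\<tau>. 1 / \<tau> powr (1 + 2 * s)) has_integral (\<rho> powr (- 2 * s) / (2 * s))) {\<rho>..}"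
    by simp
  moreover have "negligible ({\<rho>..} - {\<rho><..})" "negligible ({\<rho><..} - {\<rho>..})"
    by (auto intro: negligible_subset[of "{\<rho>}"])
  ultimately show ?thesis
    by (subst has_integral_spike_set_eq[of _ "{\<rho>..}"])
       (auto intro: negligible_subset[of "{\<rho>}"])
qed

text \<open>If \<open>B\<close> bounds \<open>u\<close>, the second difference is at most
  \<open>4 * B\<close> in absolute value, and the kernel is integrable away from 0.\<close>

lemma tail_absolutely_integrable:
  fixes u :: "'a::euclidean_space \<Rightarrow> real"
  assumes s: "0 < s" and r: "0 < \<rho>" and u: "bounded_measurable u"
  shows "(\<lambda>\<tau>. second_diff u x (\<tau> *\<^sub>R \<xi>) / \<tau> powr (1 + 2 * s)) absolutely_integrable_on {\<rho><..}"
proof -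
  obtain B where B: "\<And>x. \<bar>u x\<bar> \<le> B"
    using u unfolding bounded_measurable_def bounded_iff by auto
  have [measurable]: "(\<lambda>t. u (x + t *\<^sub>R \<xi>)) \<in> borel_measurable lebesgue" for x \<xi>
    using u unfolding bounded_measurable_def by blast
  have "(\<lambda>t. u (x + t *\<^sub>R (- \<xi>))) \<in> borel_measurable lebesgue" by measurable
  then have [measurable]: "(\<lambda>t. u (x - t *\<^sub>R \<xi>)) \<in> borel_measurable lebesgue" by simp
  have id: "(\<lambda>t::real. t powr (1 + 2 * s)) \<in> borel_measurable lebesgue"
    by (rule measurable_completion) measurable
  have "(\<lambda>\<tau>. second_diff u x (\<tau> *\<^sub>R \<xi>) / \<tau> powr (1 + 2 * s)) \<in> borel_measurable lebesgue"
    unfolding second_diff_def using id by measurable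
  then have m: "(\<lambda>\<tau>. second_diff u x (\<tau> *\<^sub>R \<xi>) / \<tau> powr (1 + 2 * s)) \<in> borel_measurable (lebesgue_on {\<rho><..})"
    by (rule measurable_restrict_space1)
  show ?thesis
  proof (rule measurable_bounded_by_integrable_imp_absolutely_integrable[OF m])
    show "(\<lambda>\<tau>. 4 * B * (1 / \<tau> powr (1 + 2 * s))) integrable_on {\<rho><..}"
      using has_integral_mult_right[OF tail_has_integral[OF s r]] by blast
    show "norm (second_diff u x (\<tau> *\<^sub>R \<xi>) / \<tau> powr (1 + 2 * s)) \<le> 4 * B * (1 / \<tau> powr (1 + 2 * s))"
      if "\<tau> \<in> {\<rho><..}" for \<tau>
    proof -
      have "\<bar>second_diff u x (\<tau> *\<^sub>R \<xi>)\<bar> \<le> 4 * B"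
        unfolding second_diff_def
        using B[of "x + \<tau> *\<^sub>R \<xi>"] B[of "x - \<tau> *\<^sub>R \<xi>"] B[of x] by linarith
      then show ?thesis using that r by (simp add: abs_divide divide_right_mono)
    qed
  qed simp
qed

text \<open>Adding \<open>le\<close> for \<open>\<tau> *\<^sub>R \<xi>\<close> and its negative
  shows that the second difference of \<open>u\<close> at \<open>x\<close> is at most that of
  \<open>v\<close> at \<open>y\<close>. Beyond distance \<open>d\<close>, \<open>far\<close>
  improves this by \<open>2 * (u x - v y)\<close>; integrating this gain against the kernel over
  \<open>{d<..}\<close> gives the subtracted term.\<close>

lemma tail_comparison:
  fixes u v :: "'a::euclidean_space \<Rightarrow> real"
  assumes s: "0 < s" and r: "0 < \<rho>" "\<rho> \<le> d"
    and u: "bounded_measurable u" and v: "bounded_measurable v" and xi: "norm \<xi> = 1"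
    and le: "\<And>z. u (x + z) - v (y + z) \<le> u x - v y"
    and far: "\<And>z. d < norm z \<Longrightarrow> u (x + z) - v (y + z) \<le> 0"
  shows "integral {\<rho><..} (\<lambda>\<tau>. second_diff u x (\<tau> *\<^sub>R \<xi>) / \<tau> powr (1 + 2 * s))
    \<le> integral {\<rho><..} (\<lambda>\<tau>. second_diff v y (\<tau> *\<^sub>R \<xi>) / \<tau> powr (1 + 2 * s))
      - (u x - v y) * (d powr (- 2 * s) / s)"
proof -
  let ?p = "\<lambda>\<tau>. \<tau> powr (1 + 2 * s)"
  let ?g = "\<lambda>\<tau>. if \<tau> \<in> {d<..} then 2 * (u x - v y) * (1 / ?p \<tau>) else 0"
  have "((\<lambda>\<tau>. 2 * (u x - v y) * (1 / ?p \<tau>)) has_integral (2 * (u x - v y) * (d powr (- 2 * s) / (2 * s)))) {d<..}"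
    using r s by (intro has_integral_mult_right tail_has_integral) auto
  then have "(?g has_integral (2 * (u x - v y) * (d powr (- 2 * s) / (2 * s)))) {\<rho><..}"
    using r by (subst has_integral_restrict) auto
  moreover have "2 * p * (q / (2 * s)) = p * (q / s)" for p q by simp
  ultimately have g: "(?g has_integral ((u x - v y) * (d powr (- 2 * s) / s))) {\<rho><..}" by metis
  note iu = absolutely_integrable_on_def[THEN iffD1, OF tail_absolutely_integrable[OF s r(1) u], THEN conjunct1]
  note iv = absolutely_integrable_on_def[THEN iffD1, OF tail_absolutely_integrable[OF s r(1) v], THEN conjunct1]
  have "second_diff u x (\<tau> *\<^sub>R \<xi>) / ?p \<tau> \<le> second_diff v y (\<tau> *\<^sub>R \<xi>) / ?p \<tau> - ?g \<tau>"
    if t: "\<tau> \<in> {\<rho><..}" for \<tau>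
  proof -
    have "second_diff u x (\<tau> *\<^sub>R \<xi>) \<le> second_diff v y (\<tau> *\<^sub>R \<xi>) - (if \<tau> \<in> {d<..} then 2 * (u x - v y) else 0)"
    proof (cases "d < \<tau>")
      case True
      with xi have "d < norm (\<tau> *\<^sub>R \<xi>)" "d < norm (- (\<tau> *\<^sub>R \<xi>))" by auto
      from far[OF this(1)] far[OF this(2)] True show ?thesis by (simp add: second_diff_def)
    next
      case False
      with le[of "\<tau> *\<^sub>R \<xi>"] le[of "- (\<tau> *\<^sub>R \<xi>)"] show ?thesis
        by (simp add: second_diff_def)
    qed
    moreover have "?p \<tau> > 0" using t r by auto
    ultimately have "second_diff u x (\<tau> *\<^sub>R \<xi>) / ?p \<tau>
        \<le> (second_diff v y (\<tau> *\<^sub>R \<xi>) - (if \<tau> \<in> {d<..} then 2 * (u x - v y) else 0)) / ?p \<tau>"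
      by (intro divide_right_mono) auto
    then show ?thesis by (auto simp: diff_divide_distrib split: if_splits)
  qed
  then show ?thesis
    using has_integral_le[OF integrable_integral[OF iu] has_integral_diff[OF integrable_integral[OF iv] g]]
    by simp
qed

section \<open>From single directions to the supremum or infimum over frames\<close>

text \<open>A shift \<open>q\<close> common to all indices survives both extrema. Only here does the
  argument distinguish the two operators.\<close>

lemma ext_mono_shift:
  fixes A B :: "'b \<Rightarrow> ereal"
  assumes ext: "ext = Sup \<or> ext = Inf" and le: "\<And>i. i \<in> I \<Longrightarrow> A i \<le> B i + ereal q"
  shows "ext (A ` I) \<le> ext (B ` I) + ereal q"
  using ext
proof
  assume "ext = Sup"
  moreover have "(SUP i\<in>I. A i) \<le> (SUP i\<in>I. B i) + ereal q"
    by (rule SUP_least) (meson le order_trans add_right_mono SUP_upper)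
  ultimately show ?thesis by simp
next
  assume "ext = Inf"
  moreover have "(INF i\<in>I. A i) - ereal q \<le> (INF i\<in>I. B i)"
    by (rule INF_greatest) (metis le order_trans INF_lower ereal_minus_le abs_ereal.simps(1) PInfty_neq_ereal(1))
  then have "(INF i\<in>I. A i) \<le> (INF i\<in>I. B i) + ereal q"
    by (simp add: ereal_minus_le)
  ultimately show ?thesis by simp
qed

text \<open>The two inequalities exclude \<open>X = -\<infinity>\<close> and
  \<open>Y = \<infinity>\<close>, and \<open>le\<close> then excludes the remaining infinite values.
  What is left is a subtraction in the reals.\<close>

lemma ereal_affine_gap:
  fixes X Y :: ereal and C g h q :: real
  assumes C: "0 < C" and X: "0 \<le> ereal C * X + ereal g" and Y: "ereal C * Y + ereal h \<le> 0"
    and le: "X \<le> Y + ereal q"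
  shows "0 \<le> C * q + (g - h)"
proof -
  obtain X' Y' where "X = ereal X'" "Y = ereal Y'"
    using assms by (cases X; cases Y) auto
  moreover from this le C have "C * X' \<le> C * (Y' + q)" by simp
  ultimately show ?thesis using X Y by (simp add: distrib_left)
qed

text \<open>The test functions are \<open>a\<close> times the squared distance to \<open>y\<close>
  for \<open>u\<close> at \<open>x\<close>, and \<open>- a\<close> times the squared distance to
  \<open>x\<close> for \<open>v\<close> at \<open>y\<close>. Subtracting the two viscosity
  inequalities and shrinking the test radius removes the quadratic terms, while the tail gain
  remains.\<close>

lemma comparison_at_touching_points:
  fixes u v :: "'a::euclidean_space \<Rightarrow> real"
  assumes s: "0 < s" "s < 1" and ext: "ext = Sup \<or> ext = Inf" and d: "0 < d"
    and sub: "viscosity_subsolution ext s k \<Omega> g u"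
    and super: "viscosity_supersolution ext s k \<Omega> g v"
    and x: "x \<in> \<Omega>" and y: "y \<in> \<Omega>" and r: "0 < r"
    and maxx: "\<And>x'. x' \<in> ball x r \<Longrightarrow> u x' - a * (norm (x' - y))\<^sup>2 \<le> u x - a * (norm (x - y))\<^sup>2"
    and maxy: "\<And>y'. y' \<in> ball y r \<Longrightarrow> - v y' - a * (norm (y' - x))\<^sup>2 \<le> - v y - a * (norm (y - x))\<^sup>2"
    and le: "\<And>z. u (x + z) - v (y + z) \<le> u x - v y"
    and far: "\<And>z. d < norm z \<Longrightarrow> u (x + z) - v (y + z) \<le> 0"
  shows "C_frac s * (real k / s) * d powr (- 2 * s) * (u x - v y) \<le> g x (u x) - g y (v y)"
proof -
  \<comment> \<open>Bounds the excess of a frame sum for \<open>u\<close> over the one for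
    \<open>v\<close>: each of the \<open>k\<close> directions carries one quadratic term from either
    test function, less the gain of \<open>tail_comparison\<close>.\<close>
  define E where "E \<rho> = real k * (2 * a * \<rho> powr (2 - 2 * s) / (1 - s) - (u x - v y) * (d powr (- 2 * s) / s))" for \<rho>
  have u: "bounded_measurable u" using sub unfolding viscosity_subsolution_def by blast
  have v: "bounded_measurable v" using super unfolding viscosity_supersolution_def by blast
  have C: "C_frac s > 0" using C_frac_pos s by blast
  have step: "0 \<le> C_frac s * E \<rho> + (g x (u x) - g y (v y))" if \<rho>: "0 < \<rho>" "\<rho> \<le> r" "\<rho> \<le> d" for \<rho>
  proof -
    let ?P = "\<lambda>\<Xi>. \<Sum>\<xi>\<in>\<Xi>.
      ext_integral {0<..<\<rho>} (\<lambda>\<tau>. second_diff (\<lambda>x. a * (norm (x - y))\<^sup>2) x (\<tau> *\<^sub>R \<xi>) / \<tau> powr (1 + 2 * s)) +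
      ext_integral {\<rho><..} (\<lambda>\<tau>. second_diff u x (\<tau> *\<^sub>R \<xi>) / \<tau> powr (1 + 2 * s))"
    let ?Q = "\<lambda>\<Xi>. \<Sum>\<xi>\<in>\<Xi>.
      ext_integral {0<..<\<rho>} (\<lambda>\<tau>. second_diff (\<lambda>y. (- a) * (norm (y - x))\<^sup>2) y (\<tau> *\<^sub>R \<xi>) / \<tau> powr (1 + 2 * s)) +
      ext_integral {\<rho><..} (\<lambda>\<tau>. second_diff v y (\<tau> *\<^sub>R \<xi>) / \<tau> powr (1 + 2 * s))"
    have P: "ereal (C_frac s) * ext (?P ` orthonormal_sets k) + ereal (g x (u x)) \<ge> 0"
      using sub x quadratic_C2_on[of a y "ball x \<rho>"] \<rho> maxx
      unfolding viscosity_subsolution_def test_operator_def by auto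
    have Q: "ereal (C_frac s) * ext (?Q ` orthonormal_sets k) + ereal (g y (v y)) \<le> 0"
    proof -
      have "v y - (- a) * (norm (y - x))\<^sup>2 \<le> v y' - (- a) * (norm (y' - x))\<^sup>2" if "y' \<in> ball y \<rho>" for y'
        using maxy[of y'] that \<rho> by auto
      then show ?thesis
        using super y quadratic_C2_on[of "- a" x "ball y \<rho>"] \<rho>(1)
        unfolding viscosity_supersolution_def test_operator_def by blast
    qed
    have "?P \<Xi> \<le> ?Q \<Xi> + ereal (E \<rho>)" if \<Xi>: "\<Xi> \<in> orthonormal_sets k" for \<Xi>
    proof -
      have n: "norm \<xi> = 1" if "\<xi> \<in> \<Xi>" for \<xi> using \<Xi> that unfolding orthonormal_sets_def by auto
      have k: "card \<Xi> = k" using \<Xi> unfolding orthonormal_sets_def by auto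
      let ?iu = "\<lambda>\<xi>. integral {\<rho><..} (\<lambda>\<tau>. second_diff u x (\<tau> *\<^sub>R \<xi>) / \<tau> powr (1 + 2 * s))"
      let ?iv = "\<lambda>\<xi>. integral {\<rho><..} (\<lambda>\<tau>. second_diff v y (\<tau> *\<^sub>R \<xi>) / \<tau> powr (1 + 2 * s))"
      have "?P \<Xi> = (\<Sum>\<xi>\<in>\<Xi>. ereal (a * \<rho> powr (2 - 2 * s) / (1 - s) + ?iu \<xi>))"
        by (intro sum.cong refl)
          (simp only: quadratic_near_integral[OF s \<rho>(1) n] ext_integral_eq[OF tail_absolutely_integrable[OF s(1) \<rho>(1) u]] plus_ereal.simps)
      moreover have "?Q \<Xi> = (\<Sum>\<xi>\<in>\<Xi>. ereal ((- a) * \<rho> powr (2 - 2 * s) / (1 - s) + ?iv \<xi>))"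
        by (intro sum.cong refl)
          (simp only: quadratic_near_integral[OF s \<rho>(1) n] ext_integral_eq[OF tail_absolutely_integrable[OF s(1) \<rho>(1) v]] plus_ereal.simps)
      moreover have "(\<Sum>\<xi>\<in>\<Xi>. a * \<rho> powr (2 - 2 * s) / (1 - s) + ?iu \<xi>) \<le>
          (\<Sum>\<xi>\<in>\<Xi>. ((- a) * \<rho> powr (2 - 2 * s) / (1 - s) + ?iv \<xi>)
            + (2 * a * \<rho> powr (2 - 2 * s) / (1 - s) - (u x - v y) * (d powr (- 2 * s) / s)))"
      proof (rule sum_mono)
        fix \<xi> assume "\<xi> \<in> \<Xi>"
        from tail_comparison[OF s(1) \<rho>(1,3) u v n[OF this] le far]
        show "a * \<rho> powr (2 - 2 * s) / (1 - s) + ?iu \<xi> \<le> ((- a) * \<rho> powr (2 - 2 * s) / (1 - s) + ?iv \<xi>)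
            + (2 * a * \<rho> powr (2 - 2 * s) / (1 - s) - (u x - v y) * (d powr (- 2 * s) / s))"
          by simp
      qed
      then have "(\<Sum>\<xi>\<in>\<Xi>. a * \<rho> powr (2 - 2 * s) / (1 - s) + ?iu \<xi>) \<le>
          (\<Sum>\<xi>\<in>\<Xi>. (- a) * \<rho> powr (2 - 2 * s) / (1 - s) + ?iv \<xi>) + E \<rho>"
        unfolding sum.distrib[of _ "\<lambda>_. 2 * a * \<rho> powr (2 - 2 * s) / (1 - s) - (u x - v y) * (d powr (- 2 * s) / s)"]
          sum_constant k E_def .
      ultimately show ?thesis by simp
    qed
    from ereal_affine_gap[OF C P Q ext_mono_shift[OF ext this]] show ?thesis .
  qed
  \<comment> \<open>Here \<open>a\<close> is fixed and the exponent \<open>2 - 2 * s\<close> is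
    positive, so only the tail gain survives.\<close>
  have "((\<lambda>\<rho>. C_frac s * E \<rho> + (g x (u x) - g y (v y))) \<longlongrightarrow>
      C_frac s * (real k * (2 * a * 0 / (1 - s) - (u x - v y) * (d powr (- 2 * s) / s))) + (g x (u x) - g y (v y))) (at_right 0)"
  proof -
    have "((\<lambda>\<rho>::real. \<rho> powr (2 - 2 * s)) \<longlongrightarrow> 0) (at_right 0)"
      by (rule tendsto_zero_powrI[OF tendsto_ident_at tendsto_const]) (use s in \<open>auto simp: eventually_at_filter\<close>)
    then show ?thesis unfolding E_def using s by (intro tendsto_intros) auto
  qed
  moreover have "eventually (\<lambda>\<rho>. 0 \<le> C_frac s * E \<rho> + (g x (u x) - g y (v y))) (at_right 0)"
    unfolding eventually_at_right_field using step r d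
    by (intro exI[of _ "min r d"]) auto
  ultimately have "0 \<le> C_frac s * (real k * (2 * a * 0 / (1 - s) - (u x - v y) * (d powr (- 2 * s) / s))) + (g x (u x) - g y (v y))"
    by (intro tendsto_lowerbound) auto
  then show ?thesis by (simp add: algebra_simps)
qed

section \<open>Doubling of variables for the Dirichlet problem\<close>

theorem theorem4p1:
  fixes \<Omega> :: "'a::euclidean_space set"
    and c f u v :: "'a \<Rightarrow> real"
    and s :: real and k :: nat
    and ext :: "ereal set \<Rightarrow> ereal"
  assumes s: "0 < s" "s < 1"
    and domain: "open \<Omega>" "connected \<Omega>" "\<Omega> \<noteq> {}" "bounded \<Omega>"
    and k: "1 \<le> k" "k \<le> DIM('a)"
    and cont: "continuous_on \<Omega> c" "continuous_on \<Omega> f"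
    and small: "(SUP x\<in>\<Omega>. ereal (max (c x) 0))
                  < ereal (C_frac s * (real k / s) * diameter \<Omega> powr (- 2 * s))"
    and ext: "ext = Sup \<or> ext = Inf"
    and usc: "usc_on (closure \<Omega>) u"
    and lsc: "lsc_on (closure \<Omega>) v"
    and sub: "Dirichlet_subsolution ext s k \<Omega> (\<lambda>x r. c x * r - f x) u"
    and super: "Dirichlet_supersolution ext s k \<Omega> (\<lambda>x r. c x * r - f x) v"
  shows "\<forall>x\<in>\<Omega>. u x \<le> v x"
proof (rule ccontr)
  assume "\<not> (\<forall>x\<in>\<Omega>. u x \<le> v x)"
  then obtain z0 where z0: "z0 \<in> \<Omega>" "v z0 < u z0" by force
  define M where "M = u z0 - v z0"
  have M: "M > 0" using z0 by (simp add: M_def)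
  define K where "K = closure \<Omega>"
  have K: "compact K" "closed K" "\<Omega> \<subseteq> K"
    using domain closure_subset by (auto simp: K_def compact_closure)
  have u0: "u x \<le> 0" if "x \<notin> \<Omega>" for x
    using sub that by (auto simp: Dirichlet_subsolution_def)
  have v0: "0 \<le> v x" if "x \<notin> \<Omega>" for x
    using super that by (auto simp: Dirichlet_supersolution_def)
  have vsub: "viscosity_subsolution ext s k \<Omega> (\<lambda>x r. c x * r - f x) u"
    using sub by (simp add: Dirichlet_subsolution_def)
  have vsuper: "viscosity_supersolution ext s k \<Omega> (\<lambda>x r. c x * r - f x) v"
    using super by (simp add: Dirichlet_supersolution_def)
  obtain Bu where Bu: "\<And>x. \<bar>u x\<bar> \<le> Bu"
    using vsub unfolding viscosity_subsolution_def bounded_measurable_def bounded_iff by auto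
  obtain Bv where Bv: "\<And>x. \<bar>v x\<bar> \<le> Bv"
    using vsuper unfolding viscosity_supersolution_def bounded_measurable_def bounded_iff by auto

  define d where "d = diameter \<Omega>"
  have d: "d > 0"
  \<comment> \<open>The open set contains a segment of length \<open>e\<close> starting at
    \<open>z0\<close>.\<close>
  proof -
    obtain e where e: "e > 0" "cball z0 e \<subseteq> \<Omega>"
      using domain z0 open_contains_cball by blast
    obtain b :: 'a where b: "b \<in> Basis" using nonempty_Basis by blast
    have "z0 + e *\<^sub>R b \<in> \<Omega>" using e b by (auto simp: dist_norm)
    then have "dist z0 (z0 + e *\<^sub>R b) \<le> d"
      unfolding d_def using domain z0 by (intro diameter_bounded_bound) auto
    then show ?thesis using e b by (simp add: dist_norm)
  qed
  define L where "L = C_frac s * (real k / s) * d powr (- 2 * s)"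
  \<comment> \<open>A real number strictly between the supremum of the positive part of
    \<open>c\<close> and \<open>L\<close>; the margin \<open>L - m\<close> has to absorb the errors
    at the end.\<close>
  obtain m where m: "m < L" "\<And>x. x \<in> \<Omega> \<Longrightarrow> c x \<le> m"
  proof -
    obtain m' where m': "(SUP x\<in>\<Omega>. ereal (max (c x) 0)) < ereal m'" "ereal m' < ereal L"
      using ereal_dense2[OF small] by (auto simp: L_def d_def)
    have "c x \<le> m'" if "x \<in> \<Omega>" for x
    proof -
      have "ereal (max (c x) 0) < ereal m'"
        using m'(1) that by (meson SUP_upper le_less_trans)
      then show ?thesis by simp
    qed
    with m' that show thesis by auto
  qed

  \<comment> \<open>Points where a semicontinuous function that is nonpositive outside \<open>\<Omega>\<close> exceeds \<open>M\<close> stay away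
    from the complement; this controls the mixed terms, with exactly one argument in \<open>\<Omega>\<close>.\<close>
  have thin: "\<exists>e>0. \<forall>x\<in>\<Omega>. M \<le> w x \<longrightarrow> ball x e \<subseteq> \<Omega>"
    if w: "usc_on K w" "\<And>x. x \<notin> \<Omega> \<Longrightarrow> w x \<le> 0" for w
  proof -
    let ?S = "{x \<in> K. M \<le> w x}"
    have "compact ?S"
      using compact_Int_closed[OF K(1) closed_superlevel_usc[OF K(2) w(1), of M]]
      by (simp add: Int_def conj_left_absorb)
    moreover have "?S \<subseteq> \<Omega>" using w(2) M by force
    ultimately obtain e where "e > 0" "(\<Union>x\<in>?S. ball x e) \<subseteq> \<Omega>"
      by (rule compact_subset_open_imp_ball_epsilon_subset[OF _ domain(1)])
    then show ?thesis using K(3) by blast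
  qed
  obtain e1 where e1: "e1 > 0" "\<And>x. x \<in> \<Omega> \<Longrightarrow> M \<le> u x \<Longrightarrow> ball x e1 \<subseteq> \<Omega>"
    using thin[of u] usc u0 by (auto simp: K_def)
  obtain e2 where e2: "e2 > 0" "\<And>x. x \<in> \<Omega> \<Longrightarrow> M \<le> - v x \<Longrightarrow> ball x e2 \<subseteq> \<Omega>"
    using thin[of "\<lambda>x. - v x"] usc_on_uminus[OF lsc] v0 by (auto simp: K_def)

  define \<Phi> where "\<Phi> n p = u (fst p) - v (snd p) - real n * (norm (fst p - snd p))\<^sup>2" for n and p :: "'a \<times> 'a"
  have "\<exists>p\<in>K \<times> K. \<forall>q\<in>K \<times> K. \<Phi> n q \<le> \<Phi> n p" for n
  proof (rule usc_attains_max)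
    show "compact (K \<times> K)" using K by (intro compact_Times) auto
    show "K \<times> K \<noteq> {}" using K z0 by auto
    show "usc_on (K \<times> K) (\<Phi> n)"
      unfolding \<Phi>_def using usc lsc
      by (intro usc_on_diff_Times continuous_intros) (auto simp: K_def)
  qed blast
  then obtain p where pK: "\<And>n. p n \<in> K \<times> K" and pmax: "\<And>n q. q \<in> K \<times> K \<Longrightarrow> \<Phi> n q \<le> \<Phi> n (p n)"
    by metis
  \<comment> \<open>Comparison with the diagonal point \<open>(z0, z0)\<close>, where the penalty is
    zero.\<close>
  have gap: "M \<le> u (fst (p n)) - v (snd (p n)) - real n * (norm (fst (p n) - snd (p n)))\<^sup>2" for n
    using pmax[of "(z0, z0)" n] z0 K by (auto simp: \<Phi>_def M_def)
  have gap': "M \<le> u (fst (p n)) - v (snd (p n))" for n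
    using gap[of n] mult_nonneg_nonneg[of "real n" "(norm (fst (p n) - snd (p n)))\<^sup>2"]
      of_nat_0_le_iff[of n] zero_le_power2[of "norm (fst (p n) - snd (p n))"] by linarith
  obtain q r where q: "q \<in> K \<times> K" and r: "strict_mono r" and lim: "(p \<circ> r) \<longlonglongrightarrow> q"
    using compact_Times[OF K(1) K(1)] pK unfolding compact_def by blast
  define a where "a = fst q"
  define X where "X n = fst (p (r n))" for n
  define Y where "Y n = snd (p (r n))" for n
  have XY: "X n \<in> K" "Y n \<in> K" for n
    using pK[of "r n"] by (auto simp: X_def Y_def mem_Times_iff)
  have X: "X \<longlonglongrightarrow> a" unfolding X_def a_def using tendsto_fst[OF lim] by (simp add: o_def)
  have Y': "Y \<longlonglongrightarrow> snd q" unfolding Y_def using tendsto_snd[OF lim] by (simp add: o_def)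
  \<comment> \<open>Since \<open>M > 0\<close>, \<open>gap\<close> bounds the penalty by
    \<open>Bu + Bv\<close>; its weight \<open>r n\<close> is at least \<open>n\<close> because
    \<open>r\<close> is strictly increasing.\<close>
  have close: "(norm (X n - Y n))\<^sup>2 \<le> (Bu + Bv) / real n" if "n > 0" for n
  proof -
    have "real n * (norm (X n - Y n))\<^sup>2 \<le> real (r n) * (norm (X n - Y n))\<^sup>2"
      using seq_suble[OF r] by (intro mult_right_mono) auto
    also have "\<dots> \<le> Bu + Bv"
      using gap[of "r n"] M Bu[of "X n"] Bv[of "Y n"] unfolding X_def Y_def by linarith
    finally show ?thesis using that by (simp add: field_simps)
  qed
  have "(\<lambda>n. (norm (X n - Y n))\<^sup>2) \<longlonglongrightarrow> 0"
    by (rule real_tendsto_sandwich[OF _ _ tendsto_const lim_const_over_n[of "Bu + Bv"]])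
      (use close in \<open>auto intro!: eventually_sequentiallyI[of 1]\<close>)
  moreover have "(\<lambda>n. (norm (X n - Y n))\<^sup>2) \<longlonglongrightarrow> (norm (a - snd q))\<^sup>2"
    using X Y' by (intro tendsto_intros)
  ultimately have "(norm (a - snd q))\<^sup>2 = 0" using LIMSEQ_unique by blast
  then have qa: "snd q = a" by simp
  with Y' have Y: "Y \<longlonglongrightarrow> a" by simp
  \<comment> \<open>With zero penalty, closed superlevel sets carry the bound \<open>M\<close> to
    the limit point \<open>(a, a)\<close>. Outside \<open>\<Omega>\<close> the difference is
    nonpositive, so \<open>a\<close> lies in \<open>\<Omega>\<close>, where \<open>c\<close> and
    \<open>f\<close> are continuous.\<close>
  have "closed {z \<in> K \<times> K. M \<le> u (fst z) - v (snd z) - 0}"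
    using usc lsc K by (intro closed_superlevel_usc usc_on_diff_Times closed_Times) (auto simp: K_def)
  moreover have "(p \<circ> r) n \<in> {z \<in> K \<times> K. M \<le> u (fst z) - v (snd z) - 0}" for n
    using pK gap' by auto
  ultimately have "q \<in> {z \<in> K \<times> K. M \<le> u (fst z) - v (snd z) - 0}"
    using lim closed_sequentially by blast
  then have "M \<le> u a - v a" using qa a_def by auto
  then have a: "a \<in> \<Omega>" using u0[of a] v0[of a] M by force

  \<comment> \<open>The error from evaluating the coefficients at two different points, in the form
    in which the final chain needs it.\<close>
  have "(\<lambda>n. (c (X n) - c (Y n)) * v (Y n) + (f (Y n) - f (X n))) \<longlonglongrightarrow> 0"
  proof -
    have cont': "isCont c a" "isCont f a"
      using cont a domain(1) by (auto simp: continuous_on_eq_continuous_at)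
    have "(\<lambda>n. c (X n) - c (Y n)) \<longlonglongrightarrow> c a - c a" "(\<lambda>n. f (Y n) - f (X n)) \<longlonglongrightarrow> f a - f a"
      by (intro tendsto_diff isCont_tendsto_compose[OF cont'(1)] isCont_tendsto_compose[OF cont'(2)] X Y)+
    moreover from this(1) have "(\<lambda>n. (c (X n) - c (Y n)) * v (Y n)) \<longlonglongrightarrow> 0"
      by (intro lim_null_mult_right_bounded[where B = Bv]) (use Bv in auto)
    ultimately show ?thesis using tendsto_add by fastforce
  qed
  then have "eventually (\<lambda>n. (c (X n) - c (Y n)) * v (Y n) + (f (Y n) - f (X n)) < (L - m) * M) sequentially"
    using M m by (intro order_tendstoD) auto
  moreover have "eventually (\<lambda>n. X n \<in> \<Omega>) sequentially" "eventually (\<lambda>n. Y n \<in> \<Omega>) sequentially"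
    using topological_tendstoD X Y domain(1) a by blast+
  moreover have "eventually (\<lambda>n. dist (X n) (Y n) < min e1 e2) sequentially"
    using tendsto_dist[OF X Y] e1 e2 by (intro order_tendstoD) auto
  ultimately have "eventually (\<lambda>n. X n \<in> \<Omega> \<and> Y n \<in> \<Omega> \<and> dist (X n) (Y n) < min e1 e2 \<and>
      (c (X n) - c (Y n)) * v (Y n) + (f (Y n) - f (X n)) < (L - m) * M) sequentially"
    by eventually_elim auto
  then obtain n where n: "X n \<in> \<Omega>" "Y n \<in> \<Omega>" "dist (X n) (Y n) < e1" "dist (X n) (Y n) < e2"
      "(c (X n) - c (Y n)) * v (Y n) + (f (Y n) - f (X n)) < (L - m) * M"
    using eventually_happens'[OF sequentially_bot] by fastforce
  define x where "x = X n"
  define y where "y = Y n"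
  have xy: "x \<in> \<Omega>" "y \<in> \<Omega>" "dist x y < e1" "dist x y < e2" using n by (auto simp: x_def y_def)
  have Mxy: "M \<le> u x - v y" using gap' by (simp add: x_def y_def X_def Y_def)
  have mx: "u x' - v y' - real (r n) * (norm (x' - y'))\<^sup>2 \<le> u x - v y - real (r n) * (norm (x - y))\<^sup>2"
    if "x' \<in> \<Omega>" "y' \<in> \<Omega>" for x' y'
    using pmax[of "(x', y')" "r n"] that K by (auto simp: \<Phi>_def x_def y_def X_def Y_def)
  obtain \<rho> where \<rho>: "\<rho> > 0" "ball x \<rho> \<subseteq> \<Omega>" "ball y \<rho> \<subseteq> \<Omega>"
  proof -
    obtain \<rho>1 \<rho>2 where "\<rho>1 > 0" "ball x \<rho>1 \<subseteq> \<Omega>" "\<rho>2 > 0" "ball y \<rho>2 \<subseteq> \<Omega>"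
      using xy domain(1) by (meson open_contains_ball)
    then show thesis by (intro that[of "min \<rho>1 \<rho>2"]) auto
  qed
  have "L * (u x - v y) \<le> (c x * u x - f x) - (c y * v y - f y)"
    unfolding L_def
  proof (rule comparison_at_touching_points[OF s ext d vsub vsuper xy(1,2) \<rho>(1), where a="real (r n)"])
    show "u x' - real (r n) * (norm (x' - y))\<^sup>2 \<le> u x - real (r n) * (norm (x - y))\<^sup>2"
      if "x' \<in> ball x \<rho>" for x'
      using mx[of x' y] that \<rho> xy by auto
    show "- v y' - real (r n) * (norm (y' - x))\<^sup>2 \<le> - v y - real (r n) * (norm (y - x))\<^sup>2"
      if "y' \<in> ball y \<rho>" for y'
      using mx[of x y'] that \<rho> xy by (auto simp: norm_minus_commute)
    \<comment> \<open>A common translation preserves \<open>x - y\<close> and hence the penalty, so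
      inside \<open>\<Omega>\<close> this is maximality. With both points outside, the signs
      suffice. With exactly one inside, the other lies within \<open>e1\<close> or \<open>e2\<close>
      of it, which forces \<open>u\<close> or \<open>- v\<close> at the inner point below
      \<open>M\<close>.\<close>
    show "u (x + z) - v (y + z) \<le> u x - v y" for z
    proof -
      have dz: "dist (x + z) (y + z) = dist x y" by (simp add: dist_norm)
      consider "x + z \<in> \<Omega>" "y + z \<in> \<Omega>" | "x + z \<notin> \<Omega>" "y + z \<notin> \<Omega>"
        | "x + z \<in> \<Omega>" "y + z \<notin> \<Omega>" | "x + z \<notin> \<Omega>" "y + z \<in> \<Omega>" by blast
      then show ?thesis
      proof cases
        case 1
        then show ?thesis using mx[of "x + z" "y + z"] by simp
      next
        case 2
        then show ?thesis using u0[of "x + z"] v0[of "y + z"] Mxy M by linarith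
      next
        case 3
        have "y + z \<in> ball (x + z) e1" using dz xy by simp
        then have "u (x + z) < M" using e1(2)[OF 3(1)] 3(2) by force
        then show ?thesis using v0[OF 3(2)] Mxy by linarith
      next
        case 4
        have "x + z \<in> ball (y + z) e2" using dz xy by (simp add: dist_commute)
        then have "- v (y + z) < M" using e2(2)[OF 4(2)] 4(1) by force
        then show ?thesis using u0[OF 4(1)] Mxy by linarith
      qed
    qed
    \<comment> \<open>Two points of \<open>\<Omega>\<close> are at most \<open>d\<close> apart, so
      such a translation moves both \<open>x\<close> and \<open>y\<close> out of
      \<open>\<Omega>\<close>.\<close>
    show "u (x + z) - v (y + z) \<le> 0" if "d < norm z" for z
    proof -
      have "w + z \<notin> \<Omega>" if "w \<in> \<Omega>" for w
      proof
        assume "w + z \<in> \<Omega>"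
        then have "dist w (w + z) \<le> d"
          unfolding d_def using domain that by (intro diameter_bounded_bound) auto
        with \<open>d < norm z\<close> show False by (simp add: dist_norm)
      qed
      then show ?thesis using u0[of "x + z"] v0[of "y + z"] xy by fastforce
    qed
  qed
  \<comment> \<open>Putting the coefficient \<open>c x\<close> on the whole difference isolates the
    error term.\<close>
  also have "\<dots> = c x * (u x - v y) + ((c x - c y) * v y + (f y - f x))" by (simp add: algebra_simps)
  also have "\<dots> < m * (u x - v y) + (L - m) * M"
  proof (rule add_le_less_mono)
    show "c x * (u x - v y) \<le> m * (u x - v y)"
      using m(2)[OF xy(1)] Mxy M by (intro mult_right_mono) auto
  qed (use n(5) in \<open>simp add: x_def y_def\<close>)
  \<comment> \<open>Because \<open>L - m > 0\<close> and \<open>M \<le> u x - v y\<close>, the chain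
    closes at \<open>L * (u x - v y)\<close>, where it began, after a strict step.\<close>
  also have "\<dots> \<le> m * (u x - v y) + (L - m) * (u x - v y)"
    using m Mxy by (intro add_left_mono mult_left_mono) auto
  finally show False by (simp add: algebra_simps)
qed

end
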